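(* For every positive integer $n$, $$\det(xI_n-A_n)=\prod_{j=1}^{n}\left[x-(-1)^{n+1}\left(2\cos\frac{(2j-1)\pi}{2n+1}\right)^{-1}\right].$$
   Context: $A_n$ is the $n\times n$ matrix whose $(i,j)$ entry is $1$ if $i+j\le n+1$ and $0$ otherwise; $I_n$ is the identity matrix. *)

theory Defs
  imports Complex_Main "Jordan_Normal_Form.Determinant"
begin

text \<open>Matrix indices in \<open>mat\<close> start at 0, hence the shift by 1 to the usual indices \<open>1, \<dots>, n\<close>.\<close>

definition A_mat :: "nat \<Rightarrow> 'a::{zero,one} mat" where
  "A_mat n = mat n n (\<lambda>(i, j). if (i + 1) + (j + 1) \<le> n + 1 then 1 else 0)"

end

theory Submission imports Defs "Jordan_Normal_Form.Char_Poly" begin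

text \<open>
  Put \<open>\<theta> = (2j - 1)\<pi> / (2n + 1)\<close> and \<open>\<beta> = \<pi> - 2\<theta>\<close>. The vector with entries \<open>cos ((i + 1/2) \<beta>)\<close>
  is an eigenvector: the sums of these cosines telescope to \<open>sin ((n - i) \<beta>) / (2 sin (\<beta>/2))\<close>,
  where \<open>sin (\<beta>/2) = cos \<theta>\<close>, and since \<open>(n + 1/2) \<beta>\<close> is an odd multiple of \<open>\<pi>/2\<close>,
  \<open>sin ((n - i) \<beta>) = (-1)^(n + 1) cos ((i + 1/2) \<beta>)\<close>. The \<open>n\<close> resulting eigenvalues are distinct,
  so they are all the roots of the characteristic polynomial.
\<close>

lemma sum_cos_half_odd:
  fixes b :: real
  shows "2 * sin (b / 2) * (\<Sum>k<m. cos ((real k + 1 / 2) * b)) = sin (real m * b)"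
proof (induction m)
  case (Suc m)
  have "2 * sin (b / 2) * cos ((real m + 1 / 2) * b) = sin (real (Suc m) * b) - sin (real m * b)"
    unfolding sin_diff_sin by (simp add: field_simps)
  with Suc show ?case
    by (simp add: algebra_simps)
qed simp

lemma char_poly_eq_prod:
  fixes A :: "'a::field mat"
  assumes A: "A \<in> carrier_mat n n" and J: "finite J" "card J = n" and inj: "inj_on l J"
    and ev: "\<And>j. j \<in> J \<Longrightarrow> eigenvalue A (l j)"
  shows "char_poly A = (\<Prod>j\<in>J. [:- l j, 1:])"
proof (rule poly_eqI_degree_lead_coeff[where n = n and A = "l ` J"])
  have deg: "degree (\<Prod>j\<in>J. [:- l j, 1:]) = n"
    using J by (subst degree_prod_eq_sum_degree) auto
  have "lead_coeff (\<Prod>j\<in>J. [:- l j, 1:]) = 1"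
    by (subst lead_coeff_prod) simp
  with deg show "coeff (char_poly A) n = coeff (\<Prod>j\<in>J. [:- l j, 1:]) n"
    using degree_monic_char_poly[OF A] by simp
  show "degree (\<Prod>j\<in>J. [:- l j, 1:]) \<le> n"
    using deg by simp
  show "degree (char_poly A) \<le> n"
    using degree_monic_char_poly[OF A] by simp
  show "n \<le> card (l ` J)"
    using J inj by (simp add: card_image)
next
  fix z assume "z \<in> l ` J"
  then show "poly (char_poly A) z = poly (\<Prod>j\<in>J. [:- l j, 1:]) z"
    using ev J eigenvalue_root_char_poly[OF A] by (auto simp: poly_prod)
qed

lemma A_mat_carrier [simp]: "A_mat n \<in> carrier_mat n n"
  by (simp add: A_mat_def)

text \<open>With indices from 0, the ones in row \<open>i\<close> occupy exactly the columns
  \<open>k < n - i\<close>.\<close>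

lemma A_mat_mult_vec:
  fixes v :: "'a::comm_ring_1 vec"
  assumes "v \<in> carrier_vec n" "i < n"
  shows "(A_mat n *\<^sub>v v) $ i = (\<Sum>k<n - i. v $ k)"
proof -
  have "(A_mat n *\<^sub>v v) $ i = (\<Sum>k<n. if k < n - i then v $ k else 0)"
    using assms
    by (auto simp: A_mat_def scalar_prod_def lessThan_atLeast0 intro!: sum.cong)
  also have "\<dots> = (\<Sum>k<n - i. v $ k)"
    by (rule sum.mono_neutral_cong_right) auto
  finally show ?thesis .
qed

lemma eigenvalue_A_mat:
  fixes t :: real
  assumes n: "n > 0" and t: "(2 * real n + 1) * t = (2 * real j - 1) * pi"
    and cos: "cos t \<noteq> 0" and sin: "sin t \<noteq> 0"
  shows "eigenvalue (A_mat n) ((-1) ^ (n + 1) * inverse (2 * cos t))"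
proof -
  define b where "b = pi - 2 * t"
  define v where "v = vec n (\<lambda>i. cos ((real i + 1 / 2) * b))"
  define l where "l = (-1) ^ (n + 1) * inverse (2 * cos t)"
  have sin_b: "sin (b / 2) = cos t"
    by (simp add: b_def diff_divide_distrib sin_diff)
  have cos_b: "cos (b / 2) = sin t"
    by (simp add: b_def diff_divide_distrib cos_diff)
  \<comment> \<open>Expanding \<open>(n + 1/2) * (pi - 2 * t)\<close> with the hypothesis on
    \<open>t\<close> gives \<open>pi / 2 + y + pi\<close>. Here \<open>y\<close> is a multiple of
    \<open>pi\<close> with the parity of \<open>n\<close>; the extra \<open>pi\<close> turns
    \<open>(-1) ^ n\<close> into \<open>(-1) ^ (n + 1)\<close>.\<close>
  define y where "y = pi * real n - pi * real (2 * j)"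
  have sin_y: "sin y = 0" and cos_y: "cos y = (-1) ^ n"
    unfolding y_def sin_diff cos_diff
    by (simp_all only: sin_npi2 cos_npi2) simp_all
  have half: "(real n + 1 / 2) * b = pi / 2 + (y + pi)"
    using t by (simp add: b_def y_def algebra_simps)
  have sin_half: "sin ((real n + 1 / 2) * b) = (-1) ^ (n + 1)"
    and cos_half: "cos ((real n + 1 / 2) * b) = 0"
    unfolding half sin_add[of "pi / 2"] cos_add[of "pi / 2"] by (simp_all add: sin_y cos_y)
  have reflect: "sin (real (n - i) * b) = (-1) ^ (n + 1) * cos ((real i + 1 / 2) * b)"
    if "i < n" for i
  proof -
    have "real (n - i) * b = (real n + 1 / 2) * b - (real i + 1 / 2) * b"
      using that by (simp add: of_nat_diff algebra_simps)
    then show ?thesis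
      by (simp add: sin_diff sin_half cos_half)
  qed
  have "A_mat n *\<^sub>v v = l \<cdot>\<^sub>v v"
  proof (rule eq_vecI)
    fix i assume "i < dim_vec (l \<cdot>\<^sub>v v)"
    then have i: "i < n"
      by (simp add: v_def)
    have "(A_mat n *\<^sub>v v) $ i = (\<Sum>k<n - i. v $ k)"
      using i by (intro A_mat_mult_vec) (auto simp: v_def)
    also have "\<dots> = (\<Sum>k<n - i. cos ((real k + 1 / 2) * b))"
      by (intro sum.cong) (auto simp: v_def)
    also have "\<dots> = sin (real (n - i) * b) / (2 * cos t)"
      using sum_cos_half_odd[of b "n - i"] cos by (simp add: sin_b field_simps)
    also have "\<dots> = (l \<cdot>\<^sub>v v) $ i"
      using i unfolding reflect[OF i] by (simp add: l_def v_def field_simps)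
    finally show "(A_mat n *\<^sub>v v) $ i = (l \<cdot>\<^sub>v v) $ i" .
  qed (simp add: A_mat_def v_def)
  \<comment> \<open>Entry 0 of \<open>v\<close> is \<open>cos (b / 2) = sin t\<close>; this is where
    \<open>sin t\<close> must be nonzero.\<close>
  moreover have "v \<noteq> 0\<^sub>v n"
  proof
    assume "v = 0\<^sub>v n"
    then have "v $ 0 = 0"
      using n by simp
    then show False
      using n cos_b sin by (simp add: v_def)
  qed
  moreover have "v \<in> carrier_vec n" "dim_row (A_mat n :: real mat) = n"
    by (simp_all add: v_def A_mat_def)
  ultimately show ?thesis
    unfolding eigenvalue_def eigenvector_def l_def by auto
qed

theorem theorem1p6:
  fixes n :: nat and x :: "'a::real_field"
  assumes "n > 0"
  shows "det (x \<cdot>\<^sub>m 1\<^sub>m n - A_mat n) =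
    (\<Prod>j=1..n. x - (-1) ^ (n + 1) *
       of_real (inverse (2 * cos ((2 * real j - 1) * pi / (2 * real n + 1)))))"
proof -
  define t where "t j = (2 * real j - 1) * pi / (2 * real n + 1)" for j :: nat
  define l where "l j = (-1) ^ (n + 1) * inverse (2 * cos (t j))" for j
  have t_eq: "(2 * real n + 1) * t j = (2 * real j - 1) * pi" for j
    by (simp add: t_def)
  have t_range: "0 < t j" "t j < pi" if "j \<in> {1..n}" for j
    using that by (auto simp: t_def divide_simps)
  \<comment> \<open>A parity argument: \<open>t j = pi / 2\<close> would give
    \<open>2 * n + 3 = 4 * j\<close>, an odd number equal to an even one.\<close>
  have cos_t: "cos (t j) \<noteq> 0" if j: "j \<in> {1..n}" for j
  proof
    assume "cos (t j) = 0"
    then have "t j = pi / 2"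
      using t_range[OF j] cos_inj_pi[of "t j" "pi / 2"] by simp
    then have "(2 * real n + 1) * pi = 2 * ((2 * real n + 1) * t j)"
      by simp
    also have "\<dots> = (2 * (2 * real j - 1)) * pi"
      unfolding t_eq by simp
    finally have "(2 * real n + 1) * pi = (2 * (2 * real j - 1)) * pi" .
    then have "2 * real n + 1 = 2 * (2 * real j - 1)"
      unfolding mult_cancel_right by simp
    then have "real (2 * n + 3) = real (4 * j)"
      by simp
    then have "2 * n + 3 = 4 * j"
      unfolding of_nat_eq_iff .
    then show False
      by presburger
  qed
  \<comment> \<open>The common sign and the inverse cancel, and cosine is injective on
    \<open>[0, pi]\<close>, where all the \<open>t j\<close> lie.\<close>
  have inj: "inj_on (\<lambda>j. of_real (l j) :: 'a) {1..n}"
  proof (rule inj_onI)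
    fix i j assume i: "i \<in> {1..n}" and j: "j \<in> {1..n}"
      and "(of_real (l i) :: 'a) = of_real (l j)"
    then have "cos (t i) = cos (t j)"
      by (simp add: l_def)
    then have "t i = t j"
      using t_range[OF i] t_range[OF j] cos_inj_pi[of "t i" "t j"] by simp
    then have "(2 * real i - 1) * pi = (2 * real j - 1) * pi"
      by (simp only: t_eq[symmetric])
    then show "i = j"
      by simp
  qed
  \<comment> \<open>The trigonometry takes place over the reals; the eigenvalue is carried to
    \<open>'a\<close> by the homomorphism \<open>of_real\<close>, which fixes the 0-1
    entries.\<close>
  have ev: "eigenvalue (A_mat n :: 'a mat) (of_real (l j))" if j: "j \<in> {1..n}" for j
  proof -
    have "eigenvalue (A_mat n) (l j)"
      unfolding l_def using assms t_range[OF j] cos_t[OF j] sin_gt_zero[of "t j"]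
      by (intro eigenvalue_A_mat[OF _ t_eq]) auto
    then have "eigenvalue (map_mat of_real (A_mat n) :: 'a mat) (of_real (l j))"
      by (rule of_real_hom.eigenvalue_hom[OF A_mat_carrier])
    also have "map_mat of_real (A_mat n) = (A_mat n :: 'a mat)"
      by (rule eq_matI) (auto simp: A_mat_def)
    finally show ?thesis .
  qed
  \<comment> \<open>Evaluation at \<open>x\<close> commutes with the determinant, so comparing
    entries suffices.\<close>
  have "det (x \<cdot>\<^sub>m 1\<^sub>m n - A_mat n) = poly (char_poly (A_mat n)) x"
    unfolding char_poly_def
    by (rule poly_det_cong[of _ n, symmetric]) (auto simp: A_mat_def char_poly_matrix_def)
  also have "char_poly (A_mat n) = (\<Prod>j=1..n. [:- of_real (l j) :: 'a, 1:])"
    using ev by (intro char_poly_eq_prod[OF A_mat_carrier _ _ inj]) auto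
  also have "poly \<dots> x = (\<Prod>j=1..n. x - of_real (l j))"
    by (simp add: poly_prod)
  finally show ?thesis
    by (simp add: l_def t_def)
qed

end
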